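(* Let $\mathcal{Y}$ be a finite set, $\mathcal{U}$ a Polish space, $\Theta\subseteq\mathbb{R}^{d_\theta}$, and $X$ a random element. For each value $x$ of $X$ and each $\theta\in\Theta$ let $\nu(\cdot\vert x;\theta)$ be a probability measure on $\mathcal{U}$ and $\epsilon\mapsto G(\epsilon\vert x;\theta)\subseteq\mathcal{Y}$ a measurable correspondence with nonempty values. Suppose there exist a total order $\precsim_{\mathcal{Y}}$ on $\mathcal{Y}$ and a total preorder $\precsim_{\mathcal{U}}$ on $\mathcal{U}$ (both allowed to depend on $X$) such that, $X$-almost surely and for all $\theta\in\Theta$: (i) $G(\epsilon\vert X;\theta)$ is connected for all $\epsilon\in\mathcal{U}$; (ii) whenever $\epsilon_1\precsim_{\mathcal{U}}\epsilon_2$, $\sup G(\epsilon_1\vert X;\theta)\precsim_{\mathcal{Y}}\sup G(\epsilon_2\vert X;\theta)$ and $\inf G(\epsilon_1\vert X;\theta)\precsim_{\mathcal{Y}}\inf G(\epsilon_2\vert X;\theta)$. Let $I$ be the cardinality of $\mathcal{Y}$ and list the elements of $\mathcal{Y}$ in increasing order with respect to $\precsim_{\mathcal{Y}}$ as $y_1,\ldots,y_I$. Then the class $$\mathcal{A}=\left(\{y_1,\ldots,y_i\},\ \{y_i,\ldots,y_I\}:\ i=1,\ldots,I\right)$$ is core determining for the set function $A\mapsto\mathcal{L}(A\vert X;\theta)=\nu(\{\epsilon: G(\epsilon\vert X;\theta)\cap A\ne\varnothing\}\vert X;\theta)$, $X$-almost surely and for all $\theta\in\Theta$.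
   Context: Measurable correspondence: for almost all $x$ and all $\theta$, for every $A\subseteq\mathcal{Y}$ the set $\{\epsilon\in\mathcal{U}: G(\epsilon\vert x;\theta)\cap A\ne\varnothing\}$ is measurable. A subset $A$ of an ordered set $(S,\preceq)$ is connected if every $a\in S$ with $\inf A\preceq a\preceq\sup A$ belongs to $A$. A class $\mathcal{A}$ of subsets of $\mathcal{Y}$ is core determining for a set function $\mathcal{L}$ on $\mathcal{Y}$ if for every probability $Q$ on $\mathcal{Y}$, $Q(A)\leq\mathcal{L}(A)$ for all $A\in\mathcal{A}$ implies $Q(A)\leq\mathcal{L}(A)$ for all $A\subseteq\mathcal{Y}$. *)

theory Defs
  imports "HOL-Probability.Probability"
begin

text \<open>
  An order on a set \<open>S\<close> is a relation \<open>r\<close> with \<^term>\<open>linear_order_on S r\<close> or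
  \<^term>\<open>preorder_on S r\<close>, so that \<open>S\<close> is the field of \<open>r\<close> and
  \<open>(a, b) \<in> r\<close> reads \<open>a \<preceq> b\<close>. The constants \<^const>\<open>Above\<close> and \<^const>\<open>Under\<close>
  give the upper and lower bounds of a set in the field of \<open>r\<close>.
\<close>

definition order_sup :: "'a rel \<Rightarrow> 'a set \<Rightarrow> 'a" where
  "order_sup r A = (THE s. s \<in> Above r A \<and> (\<forall>b\<in>Above r A. (s, b) \<in> r))"

definition order_inf :: "'a rel \<Rightarrow> 'a set \<Rightarrow> 'a" where
  "order_inf r A = (THE s. s \<in> Under r A \<and> (\<forall>b\<in>Under r A. (b, s) \<in> r))"

definition order_connected :: "'a set \<Rightarrow> 'a rel \<Rightarrow> 'a set \<Rightarrow> bool" where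
  "order_connected S r A \<longleftrightarrow>
     A \<subseteq> S \<and> (\<forall>a\<in>S. (order_inf r A, a) \<in> r \<and> (a, order_sup r A) \<in> r \<longrightarrow> a \<in> A)"

definition increasing_listing :: "'a set \<Rightarrow> 'a rel \<Rightarrow> (nat \<Rightarrow> 'a) \<Rightarrow> bool" where
  "increasing_listing S r y \<longleftrightarrow>
     bij_betw y {1..card S} S \<and>
     (\<forall>i\<in>{1..card S}. \<forall>j\<in>{1..card S}. i \<le> j \<longrightarrow> (y i, y j) \<in> r)"

definition measurable_correspondence ::
  "'u measure \<Rightarrow> 'y set \<Rightarrow> ('u \<Rightarrow> 'y set) \<Rightarrow> bool" where
  "measurable_correspondence U Y G \<longleftrightarrow>
     (\<forall>A. A \<subseteq> Y \<longrightarrow> {\<epsilon>\<in>space U. G \<epsilon> \<inter> A \<noteq> {}} \<in> sets U)"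

text \<open>
  The set \<open>Y\<close> is finite in all uses, so a probability on \<open>Y\<close> is one on the
  \<open>\<sigma>\<close>-algebra of all subsets of \<open>Y\<close>.
\<close>

definition core_determining ::
  "'y set \<Rightarrow> ('y set \<Rightarrow> real) \<Rightarrow> 'y set set \<Rightarrow> bool" where
  "core_determining Y L \<A> \<longleftrightarrow>
     \<A> \<subseteq> Pow Y \<and>
     (\<forall>Q. prob_space Q \<and> sets Q = Pow Y \<longrightarrow>
        (\<forall>A\<in>\<A>. measure Q A \<le> L A) \<longrightarrow> (\<forall>A. A \<subseteq> Y \<longrightarrow> measure Q A \<le> L A))"

end

theory Submission
  imports Defs
begin

text \<open>
  Passing to complements, the claim reads \<open>P (H \<subseteq> B) \<le> Q B\<close> for all \<open>B\<close>, where \<open>H\<close> is the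
  random set. As \<open>H\<close> is connected, \<open>H \<subseteq> B\<close> forces \<open>H\<close> into one of the maximal intervals of
  \<open>B\<close>, so by additivity only intervals \<open>B = {c..d}\<close> matter. By monotonicity of both endpoints,
  if some value of \<open>H\<close> lies in \<open>{c..d}\<close> then no value extends beyond it on both sides. So either
  \<open>P (H \<subseteq> {c..d})\<close> vanishes, or it equals one minus the probabilities of hitting \<open>{..<c}\<close> and
  \<open>{d<..}\<close>, and these are bounded below by hypothesis.
\<close>

section \<open>Containment probabilities of comonotone random intervals\<close>

lemma comonotone_interval_bound:
  fixes H :: "'u \<Rightarrow> 'a::linorder set"
  assumes P: "prob_space P" and Q: "prob_space Q" "sets Q = Pow S" and S: "finite S"
    and HS: "\<And>e. H e \<subseteq> S" and ne: "\<And>e. H e \<noteq> {}"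
    and meas: "\<And>A. A \<subseteq> S \<Longrightarrow> {e\<in>space P. H e \<inter> A \<noteq> {}} \<in> sets P"
    and comono: "\<And>e e'. Min (H e) \<le> Min (H e') \<and> Max (H e) \<le> Max (H e') \<or>
                        Min (H e') \<le> Min (H e) \<and> Max (H e') \<le> Max (H e)"
    and lower: "\<And>c. measure Q {x\<in>S. x < c} \<le> measure P {e\<in>space P. H e \<inter> {x\<in>S. x < c} \<noteq> {}}"
    and upper: "\<And>d. measure Q {x\<in>S. d < x} \<le> measure P {e\<in>space P. H e \<inter> {x\<in>S. d < x} \<noteq> {}}"
    and cd: "c \<le> d"
  shows "measure P {e\<in>space P. H e \<subseteq> {c..d}} \<le> measure Q (S \<inter> {c..d})"
proof -
  interpret P: prob_space P by fact
  interpret Q: prob_space Q by fact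
  have spQ: "space Q = S"
    using Q(2) sets.top[of Q] sets.sets_into_space[of S Q] by auto
  have fin: "finite (H e)" for e
    using HS S finite_subset by blast
  define E1 where "E1 = {e\<in>space P. H e \<inter> {x\<in>S. x < c} \<noteq> {}}"
  define E2 where "E2 = {e\<in>space P. H e \<inter> {x\<in>S. d < x} \<noteq> {}}"
  have m: "E1 \<in> sets P" "E2 \<in> sets P"
    unfolding E1_def E2_def by (rule meas; auto)+
  have E: "{e\<in>space P. H e \<subseteq> {c..d}} = space P - (E1 \<union> E2)"
    unfolding E1_def E2_def using HS by (fastforce simp: not_le)
  \<comment> \<open>The complement of \<open>E1 \<union> E2\<close> has probability
    \<open>1 - P E1 - P E2 + P (E1 \<inter> E2)\<close>, and the lower bounds on \<open>P E1\<close>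
    and \<open>P E2\<close> control everything but the overlap. Comonotonicity has to rule the
    overlap out or make the left side zero.\<close>
  show ?thesis
  proof (cases "E1 \<inter> E2 = {}")
    case True
    have "measure P (space P - (E1 \<union> E2)) = 1 - (measure P E1 + measure P E2)"
      using m True by (simp add: P.prob_compl P.finite_measure_Union)
    moreover have "measure Q (S - ({x\<in>S. x < c} \<union> {x\<in>S. d < x})) =
        1 - (measure Q {x\<in>S. x < c} + measure Q {x\<in>S. d < x})"
    proof -
      \<comment> \<open>The assumption \<open>c \<le> d\<close> makes the two tails of
        \<open>S\<close> disjoint, so \<open>Q\<close> is additive on them.\<close>
      have Qm: "{x\<in>S. x < c} \<union> {x\<in>S. d < x} \<in> sets Q" "{x\<in>S. x < c} \<in> sets Q"
        "{x\<in>S. d < x} \<in> sets Q" "{x\<in>S. x < c} \<inter> {x\<in>S. d < x} = {}"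
        using Q(2) cd by auto
      show ?thesis
        using Q.prob_compl[OF Qm(1)] Q.finite_measure_Union[OF Qm(2,3,4)] by (simp only: spQ)
    qed
    moreover have "S - ({x\<in>S. x < c} \<union> {x\<in>S. d < x}) = S \<inter> {c..d}"
      by auto
    ultimately show ?thesis
      using lower[of c] upper[of d] E unfolding E1_def E2_def by simp
  next
    case False
    then obtain e where e: "e \<in> E1" "e \<in> E2" by auto
    have a: "Min (H e) < c" "d < Max (H e)"
      using e fin[of e] ne[of e] by (auto simp: E1_def E2_def Min_less_iff Max_gr_iff)
    \<comment> \<open>The set \<open>H e\<close> sticks out of \<open>{c..d}\<close> on both sides.
      A set inside \<open>{c..d}\<close> would have a strictly larger minimum and a strictly smaller
      maximum than \<open>H e\<close>, so the two would not be comonotone.\<close>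
    have "\<not> H e' \<subseteq> {c..d}" for e'
    proof
      assume "H e' \<subseteq> {c..d}"
      then have "c \<le> Min (H e')" "Max (H e') \<le> d"
        using fin[of e'] ne[of e'] by auto
      then show False
        using a comono[of e e'] by force
    qed
    then show ?thesis by simp
  qed
qed

text \<open>Split off the topmost maximal interval \<open>C\<close> of \<open>B\<close>: a convex
  set inside \<open>B\<close> lies in \<open>C\<close> or in \<open>B - C\<close>. The interval
  bound handles \<open>C\<close> and induction handles \<open>B - C\<close>. Subadditivity of
  \<open>P\<close> and additivity of \<open>Q\<close> then put the two pieces together.\<close>

lemma comonotone_containment_bound:
  fixes H :: "'u \<Rightarrow> 'a::linorder set"
  assumes P: "prob_space P" and Q: "prob_space Q" "sets Q = Pow S" and S: "finite S"
    and HS: "\<And>e. H e \<subseteq> S" and ne: "\<And>e. H e \<noteq> {}"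
    and meas: "\<And>A. A \<subseteq> S \<Longrightarrow> {e\<in>space P. H e \<inter> A \<noteq> {}} \<in> sets P"
    and conv: "\<And>e x z w. x \<in> H e \<Longrightarrow> w \<in> H e \<Longrightarrow> z \<in> S \<Longrightarrow> x \<le> z \<Longrightarrow> z \<le> w \<Longrightarrow> z \<in> H e"
    and comono: "\<And>e e'. Min (H e) \<le> Min (H e') \<and> Max (H e) \<le> Max (H e') \<or>
                        Min (H e') \<le> Min (H e) \<and> Max (H e') \<le> Max (H e)"
    and lower: "\<And>c. measure Q {x\<in>S. x < c} \<le> measure P {e\<in>space P. H e \<inter> {x\<in>S. x < c} \<noteq> {}}"
    and upper: "\<And>d. measure Q {x\<in>S. d < x} \<le> measure P {e\<in>space P. H e \<inter> {x\<in>S. d < x} \<noteq> {}}"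
    and "B \<subseteq> S"
  shows "measure P {e\<in>space P. H e \<subseteq> B} \<le> measure Q B"
proof -
  interpret P: prob_space P by fact
  interpret Q: prob_space Q by fact
  have meas': "{e\<in>space P. H e \<subseteq> B} \<in> sets P" for B
  proof -
    have "{e\<in>space P. H e \<subseteq> B} = space P - {e\<in>space P. H e \<inter> (S - B) \<noteq> {}}"
      using HS by fastforce
    then show ?thesis using meas[of "S - B"] by auto
  qed
  have "finite B" using \<open>B \<subseteq> S\<close> S by (rule finite_subset)
  then show ?thesis using \<open>B \<subseteq> S\<close>
  proof (induction B rule: finite_psubset_induct)
    case (psubset B)
    show ?case
    proof (cases "B = {}")
      case True
      then show ?thesis using ne by simp
    next
      case False
      define m where "m = Max B"
      \<comment> \<open>the topmost maximal interval of \<open>B\<close>\<close>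
      define C where "C = {x\<in>B. \<forall>z\<in>S. x \<le> z \<and> z \<le> m \<longrightarrow> z \<in> B}"
      define c where "c = Min C"
      have mB: "m \<in> B" "\<And>x. x \<in> B \<Longrightarrow> x \<le> m"
        using psubset False by (auto simp: m_def)
      have finC: "finite C" using psubset by (simp add: C_def)
      have mC: "m \<in> C" using mB by (auto simp: C_def dest: antisym)
      have cC: "c \<in> C" "\<And>x. x \<in> C \<Longrightarrow> c \<le> x"
        using Min_in[OF finC] Min_le[OF finC] mC unfolding c_def by blast+
      \<comment> \<open>Since \<open>c\<close> itself belongs to \<open>C\<close>, all points of
        \<open>S\<close> between \<open>c\<close> and \<open>m\<close> lie in \<open>B\<close>, and
        each of them inherits the defining property of \<open>C\<close>.\<close>
      have C: "C = S \<inter> {c..m}"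
      proof (intro set_eqI iffI)
        fix x assume "x \<in> C"
        then show "x \<in> S \<inter> {c..m}" using cC(2) mB(2) psubset.prems by (auto simp: C_def)
      next
        fix x assume x: "x \<in> S \<inter> {c..m}"
        have "\<forall>z\<in>S. c \<le> z \<and> z \<le> m \<longrightarrow> z \<in> B" using cC(1) by (simp add: C_def)
        then show "x \<in> C" using x by (auto simp: C_def)
      qed
      have "measure P {e\<in>space P. H e \<subseteq> B} \<le>
          measure P ({e\<in>space P. H e \<subseteq> B - C} \<union> {e\<in>space P. H e \<subseteq> C})"
      proof (rule P.finite_measure_mono)
        \<comment> \<open>If both fail, some \<open>x\<close> of \<open>H e\<close> is outside
          \<open>C\<close> and some \<open>w\<close> is in \<open>C\<close>. A point
          \<open>z\<close> of \<open>S - B\<close> separates \<open>x\<close> from \<open>m\<close>.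
          It must lie below \<open>c\<close>, hence between \<open>x\<close> and \<open>w\<close>,
          and convexity forces it into \<open>H e \<subseteq> B\<close>.\<close>
        have "H e \<subseteq> B - C \<or> H e \<subseteq> C" if H: "H e \<subseteq> B" for e
        proof (rule ccontr)
          assume "\<not> (H e \<subseteq> B - C \<or> H e \<subseteq> C)"
          then obtain x w where x: "x \<in> H e" "x \<notin> C" and w: "w \<in> H e" "w \<in> C"
            using H by auto
          then obtain z where z: "z \<in> S" "x \<le> z" "z \<le> m" "z \<notin> B"
            using H by (auto simp: C_def)
          then have "z < c"
            using C cC(1) by (force simp: C_def not_le[symmetric])
          then have "z \<le> w" using cC(2)[OF w(2)] by simp
          then have "z \<in> H e" using conv x w z by blast
          then show False using H z by auto
        qed
        then show "{e\<in>space P. H e \<subseteq> B} \<subseteq>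
            {e\<in>space P. H e \<subseteq> B - C} \<union> {e\<in>space P. H e \<subseteq> C}" by blast
      qed (intro sets.Un meas')
      also have "\<dots> \<le> measure P {e\<in>space P. H e \<subseteq> B - C} + measure P {e\<in>space P. H e \<subseteq> C}"
        by (rule measure_Un_le) (rule meas')+
      also have "measure P {e\<in>space P. H e \<subseteq> B - C} \<le> measure Q (B - C)"
        using mB mC psubset.prems by (intro psubset.IH) auto
      also have "measure P {e\<in>space P. H e \<subseteq> C} \<le> measure Q C"
      proof -
        have "{e\<in>space P. H e \<subseteq> C} = {e\<in>space P. H e \<subseteq> {c..m}}"
          using HS C by auto
        then show ?thesis
          using comonotone_interval_bound[OF P Q S HS ne meas comono lower upper, of c m]
            cC(2)[OF mC] C by simp
      qed
      also have "measure Q (B - C) + measure Q C = measure Q ((B - C) \<union> C)"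
        using psubset.prems Q(2) C by (subst Q.finite_measure_Union) auto
      also have "(B - C) \<union> C = B" by (auto simp: C_def)
      finally show ?thesis by simp
    qed
  qed
qed

section \<open>Increasing listings of a finite linear order\<close>

text \<open>Monotonicity is part of the definition of a listing. The converse combines antisymmetry
  of \<open>r\<close> with injectivity of \<open>y\<close>.\<close>

lemma increasing_listing_iff:
  assumes r: "linear_order_on S r" and y: "increasing_listing S r y"
    and i: "i \<in> {1..card S}" and j: "j \<in> {1..card S}"
  shows "(y i, y j) \<in> r \<longleftrightarrow> i \<le> j"
proof
  assume ij: "(y i, y j) \<in> r"
  show "i \<le> j"
  proof (rule ccontr)
    assume "\<not> i \<le> j"
    then have "(y j, y i) \<in> r" using y i j by (auto simp: increasing_listing_def)
    then have "y i = y j"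
      using ij r by (auto simp: order_on_defs antisym_def)
    moreover have "inj_on y {1..card S}"
      using y by (simp only: increasing_listing_def bij_betw_def)
    ultimately have "i = j" using i j by (simp only: inj_on_eq_iff)
    then show False using \<open>\<not> i \<le> j\<close> by simp
  qed
next
  assume "i \<le> j"
  have "\<forall>i\<in>{1..card S}. \<forall>j\<in>{1..card S}. i \<le> j \<longrightarrow> (y i, y j) \<in> r"
    using y unfolding increasing_listing_def by (rule conjunct2)
  from this[rule_format, OF i j \<open>i \<le> j\<close>] show "(y i, y j) \<in> r" .
qed

text \<open>The bounds are attained: the element with the largest index is in the set, so every
  upper bound dominates it, and dually for the smallest. Antisymmetry supplies the uniqueness
  demanded by \<open>THE\<close>.\<close>

lemma
  assumes r: "linear_order_on S r" and y: "increasing_listing S r y"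
    and I: "I \<subseteq> {1..card S}" "I \<noteq> {}"
  shows order_sup_image: "order_sup r (y ` I) = y (Max I)"
    and order_inf_image: "order_inf r (y ` I) = y (Min I)"
proof -
  have fin: "finite I" using I(1) finite_subset by blast
  have in_I: "Max I \<in> I" "Min I \<in> I" using fin I(2) by auto
  have y_in: "y i \<in> S" if "i \<in> I" for i
    using y I(1) that by (auto simp: increasing_listing_def bij_betw_def)
  have field: "Field r = S"
    using r by (auto simp: order_on_defs refl_on_def Field_def)
  have le: "(y i, y j) \<in> r" if "i \<in> I" "j \<in> I" "i \<le> j" for i j
    using that I(1) by (subst increasing_listing_iff[OF r y]) auto
  have anti: "a = b" if "(a, b) \<in> r" "(b, a) \<in> r" for a b
    using r that by (auto simp: order_on_defs antisym_def)
  have above: "y (Max I) \<in> Above r (y ` I)"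
    using in_I y_in le fin by (auto simp: Above_def field)
  have below: "y (Min I) \<in> Under r (y ` I)"
    using in_I y_in le fin by (auto simp: Under_def field)
  show "order_sup r (y ` I) = y (Max I)"
    unfolding order_sup_def
  proof (rule the_equality)
    show "y (Max I) \<in> Above r (y ` I) \<and> (\<forall>b\<in>Above r (y ` I). (y (Max I), b) \<in> r)"
      using above in_I by (auto simp: Above_def)
  qed (use above in_I anti in \<open>auto simp: Above_def\<close>)
  show "order_inf r (y ` I) = y (Min I)"
    unfolding order_inf_def
  proof (rule the_equality)
    show "y (Min I) \<in> Under r (y ` I) \<and> (\<forall>b\<in>Under r (y ` I). (b, y (Min I)) \<in> r)"
      using below in_I by (auto simp: Under_def)
  qed (use below in_I anti in \<open>auto simp: Under_def\<close>)
qed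

section \<open>Half-lines as a core determining class\<close>

text \<open>This is the claim for one fixed \<open>x\<close> and \<open>\<theta>\<close>. The
  listing carries everything over to \<open>{1..n}\<close> with the usual order, where suprema and
  infima become \<open>Max\<close> and \<open>Min\<close> and the containment bound applies.\<close>

lemma core_determining_half_lines:
  fixes P :: "'u measure"
  assumes P: "prob_space P" and r: "linear_order_on S r"
    and y: "increasing_listing S r y"
    and G: "\<And>e. G e \<subseteq> S" "\<And>e. G e \<noteq> {}"
    and spP: "space P = UNIV"
    and meas: "measurable_correspondence P S G"
    and conn: "\<And>e. order_connected S r (G e)"
    and U: "total_on UNIV U" "refl U"
    and mono: "\<And>e e'. (e, e') \<in> U \<Longrightarrow> (order_sup r (G e), order_sup r (G e')) \<in> r \<and>
                                    (order_inf r (G e), order_inf r (G e')) \<in> r"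
  shows "core_determining S (\<lambda>A. measure P {e. G e \<inter> A \<noteq> {}})
           (\<Union>i\<in>{1..card S}. {y ` {1..i}, y ` {i..card S}})"
    (is "core_determining S ?L ?A")
  unfolding core_determining_def
proof (intro conjI allI impI)
  define n where "n = card S"
  have bij: "bij_betw y {1..n} S"
    using y by (simp add: increasing_listing_def n_def)
  then have img: "y ` {1..n} = S" and inj: "inj_on y {1..n}"
    by (auto simp: bij_betw_def)
  have "y ` {1..i} \<subseteq> S \<and> y ` {i..n} \<subseteq> S" if "i \<in> {1..n}" for i
    using that img image_mono[of "{1..i}" "{1..n}" y] image_mono[of "{i..n}" "{1..n}" y] by simp
  then show "?A \<subseteq> Pow S"
    unfolding n_def[symmetric] by (simp add: UN_subset_iff)
  fix Q A
  assume Q: "prob_space Q \<and> sets Q = Pow S" and QA: "\<forall>A\<in>?A. measure Q A \<le> ?L A"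
    and A: "A \<subseteq> S"
  interpret P: prob_space P by fact
  interpret Q: prob_space Q using Q by simp
  have spQ: "space Q = S"
    using Q sets.top[of Q] sets.sets_into_space[of S Q] by auto
  \<comment> \<open>\<open>H\<close> is the correspondence read in indices, and \<open>R\<close> is
    the image of \<open>Q\<close> under the inverse of the listing.\<close>
  define H where "H e = {i\<in>{1..n}. y i \<in> G e}" for e
  define R where "R = distr Q (count_space {1..n}) (the_inv_into {1..n} y)"
  have GH: "G e = y ` H e" for e
    using G(1)[of e] img by (auto simp: H_def)
  have Hn: "H e \<subseteq> {1..n}" for e by (auto simp: H_def)
  have Hne: "H e \<noteq> {}" for e using G(2)[of e] GH by auto
  have fin: "finite (H e)" for e by (simp add: H_def)
  have inMM: "Max (H e) \<in> {1..n}" "Min (H e) \<in> {1..n}" for e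
    using Max_in[OF fin Hne, of e] Min_in[OF fin Hne, of e] Hn by blast+
  have sup: "order_sup r (G e) = y (Max (H e))" and inf: "order_inf r (G e) = y (Min (H e))" for e
    using order_sup_image[OF r y] order_inf_image[OF r y] Hn Hne GH n_def by metis+
  have le_iff: "(y i, y j) \<in> r \<longleftrightarrow> i \<le> j" if "i \<in> {1..n}" "j \<in> {1..n}" for i j
    using increasing_listing_iff[OF r y] that by (simp add: n_def)
  have meas_inv: "the_inv_into {1..n} y \<in> measurable Q (count_space {1..n})"
  proof (rule measurableI)
    fix x assume "x \<in> space Q"
    then show "the_inv_into {1..n} y x \<in> space (count_space {1..n})"
      using bij_betw_apply[OF bij_betw_the_inv_into[OF bij]] by (simp only: spQ space_count_space)
  qed (use Q spQ in auto)
  have R: "prob_space R" "sets R = Pow {1..n}"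
    unfolding R_def using Q.prob_space_distr[OF meas_inv] by simp_all
  have measR: "measure R B = measure Q (y ` B)" if "B \<subseteq> {1..n}" for B
  proof -
    have "the_inv_into {1..n} y -` B \<inter> S = y ` B"
      using that by (auto simp only: img[symmetric] the_inv_into_f_f[OF inj] subset_iff vimage_eq
          Int_iff image_iff)
    then show ?thesis
      unfolding R_def using that by (subst measure_distr[OF meas_inv]) (auto simp: spQ)
  qed
  have hit: "G e \<inter> y ` B \<noteq> {} \<longleftrightarrow> H e \<inter> B \<noteq> {}" if "B \<subseteq> {1..n}" for e B
    unfolding H_def using that by blast
  have measH: "{e\<in>space P. H e \<inter> B \<noteq> {}} \<in> sets P" if "B \<subseteq> {1..n}" for B
    using meas[unfolded measurable_correspondence_def, rule_format, of "y ` B"]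
      image_mono[OF that, of y] by (simp only: img hit[OF that])
  have bound: "measure R B \<le> measure P {e\<in>space P. H e \<inter> B \<noteq> {}}"
    if "B \<subseteq> {1..n}" "y ` B \<in> ?A" for B
    using QA[rule_format, OF that(2)] hit[OF that(1)] measR[OF that(1)] by (simp add: spP)
  have half_lines: "measure R {1..i} \<le> measure P {e\<in>space P. H e \<inter> {1..i} \<noteq> {}}"
    "measure R {i..n} \<le> measure P {e\<in>space P. H e \<inter> {i..n} \<noteq> {}}" if "i \<in> {1..n}" for i
    by (intro bound UN_I[of i]; use that in \<open>simp add: n_def\<close>)+
  obtain B where B: "B \<subseteq> {1..n}" "A = y ` B"
    using A img by (metis subset_imageE)
  \<comment> \<open>Missing \<open>B\<close> is the same as being contained in its complement, so
    the containment bound for \<open>{1..n} - B\<close> is the hitting bound for \<open>B\<close>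
    after subtracting from one.\<close>
  have "measure P {e\<in>space P. H e \<subseteq> {1..n} - B} \<le> measure R ({1..n} - B)"
  proof (rule comonotone_containment_bound[OF P R])
    fix e x z w
    assume "x \<in> H e" "w \<in> H e" "z \<in> {1..n}" "x \<le> z" "z \<le> w"
    \<comment> \<open>Connectedness speaks of points between the infimum and the supremum, which are
      \<open>y (Min (H e))\<close> and \<open>y (Max (H e))\<close>.\<close>
    then have "Min (H e) \<le> z" "z \<le> Max (H e)"
      using fin[of e] by (meson Min_le Max_ge order_trans)+
    moreover have "y z \<in> S" using \<open>z \<in> {1..n}\<close> img by blast
    ultimately have "y z \<in> G e"
      using conn[of e] le_iff inMM[of e] \<open>z \<in> {1..n}\<close>
      unfolding order_connected_def sup inf by blast
    then show "z \<in> H e" using \<open>z \<in> {1..n}\<close> by (simp add: H_def)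
  next
    fix e e'
    \<comment> \<open>\<open>total_on\<close> compares distinct points only; reflexivity covers
      \<open>e = e'\<close>.\<close>
    have "(e, e') \<in> U \<or> (e', e) \<in> U"
      using U by (metis UNIV_I refl_onD total_on_def)
    then show "Min (H e) \<le> Min (H e') \<and> Max (H e) \<le> Max (H e') \<or>
               Min (H e') \<le> Min (H e) \<and> Max (H e') \<le> Max (H e)"
      using mono[of e e'] mono[of e' e] inMM[of e] inMM[of e'] by (simp only: sup inf le_iff) blast
  next
    fix c
    \<comment> \<open>The class holds only segments indexed by \<open>{1..n}\<close>, so the empty
      tail is treated apart, with measure zero on the left. Otherwise the tail ends at
      \<open>c - 1\<close>, capped at \<open>n\<close> since \<open>c\<close> is arbitrary.\<close>
    consider "{x\<in>{1..n}. x < c} = {}"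
      | i where "i \<in> {1..n}" "{x\<in>{1..n}. x < c} = {1..i}"
    proof (cases "{x\<in>{1..n}. x < c} = {}")
      case False
      then have "min (c - 1) n \<in> {1..n}" "{x\<in>{1..n}. x < c} = {1..min (c - 1) n}"
        by auto
      then show ?thesis using that(2) by blast
    qed (use that(1) in blast)
    then show "measure R {x\<in>{1..n}. x < c} \<le> measure P {e\<in>space P. H e \<inter> {x\<in>{1..n}. x < c} \<noteq> {}}"
      by cases (simp_all only: half_lines Int_empty_right measure_empty measure_nonneg)
  next
    fix d
    consider "{x\<in>{1..n}. d < x} = {}"
      | i where "i \<in> {1..n}" "{x\<in>{1..n}. d < x} = {i..n}"
    proof (cases "{x\<in>{1..n}. d < x} = {}")
      case False
      \<comment> \<open>Strictness of \<open>d < x\<close> makes the tail start at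
        \<open>Suc d\<close>; it is nonempty, so \<open>Suc d \<le> n\<close>.\<close>
      then have "Suc d \<in> {1..n}" "{x\<in>{1..n}. d < x} = {Suc d..n}"
        by auto
      then show ?thesis using that(2) by blast
    qed (use that(1) in blast)
    then show "measure R {x\<in>{1..n}. d < x} \<le> measure P {e\<in>space P. H e \<inter> {x\<in>{1..n}. d < x} \<noteq> {}}"
      by cases (simp_all only: half_lines Int_empty_right measure_empty measure_nonneg)
  qed (use Hn Hne measH in auto)
  moreover have "{e\<in>space P. H e \<subseteq> {1..n} - B} = space P - {e\<in>space P. H e \<inter> B \<noteq> {}}"
    using Hn by fastforce
  moreover have "measure R ({1..n} - B) = 1 - measure R B"
    using prob_space.prob_compl[OF R(1), of B] R(2) B(1) by (simp add: R_def)
  ultimately have "measure R B \<le> measure P {e\<in>space P. H e \<inter> B \<noteq> {}}"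
    using P.prob_compl[OF measH[OF B(1)]] by simp
  then show "measure Q A \<le> ?L A"
    using B hit[OF B(1)] measR[OF B(1)] by (simp add: spP)
qed

theorem theorem4:
  fixes M :: "'w measure" and N :: "'x measure" and X :: "'w \<Rightarrow> 'x"
    and Y :: "'y set" and \<Theta> :: "(real ^ 'd) set"
    and \<nu> :: "'x \<Rightarrow> real ^ 'd \<Rightarrow> 'u::polish_space measure"
    and G :: "'x \<Rightarrow> real ^ 'd \<Rightarrow> 'u \<Rightarrow> 'y set"
    and leY :: "'x \<Rightarrow> 'y rel" and leU :: "'x \<Rightarrow> 'u rel"
    and y :: "'x \<Rightarrow> nat \<Rightarrow> 'y"
  assumes "prob_space M" and "X \<in> measurable M N"
    and "finite Y"
    and "\<And>x \<theta>. x \<in> X ` space M \<Longrightarrow> \<theta> \<in> \<Theta> \<Longrightarrow>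
           prob_space (\<nu> x \<theta>) \<and> sets (\<nu> x \<theta>) = sets borel"
    and "\<And>x \<theta> \<epsilon>. x \<in> X ` space M \<Longrightarrow> \<theta> \<in> \<Theta> \<Longrightarrow> G x \<theta> \<epsilon> \<subseteq> Y \<and> G x \<theta> \<epsilon> \<noteq> {}"
    and "AE \<omega> in M. \<forall>\<theta>\<in>\<Theta>. measurable_correspondence borel Y (G (X \<omega>) \<theta>)"
    and "\<And>x. x \<in> X ` space M \<Longrightarrow> linear_order_on Y (leY x)"
    and "\<And>x. x \<in> X ` space M \<Longrightarrow> preorder_on UNIV (leU x) \<and> total_on UNIV (leU x)"
    and "AE \<omega> in M. \<forall>\<theta>\<in>\<Theta>. \<forall>\<epsilon>. order_connected Y (leY (X \<omega>)) (G (X \<omega>) \<theta> \<epsilon>)"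
    and "AE \<omega> in M. \<forall>\<theta>\<in>\<Theta>. \<forall>\<epsilon>\<^sub>1 \<epsilon>\<^sub>2. (\<epsilon>\<^sub>1, \<epsilon>\<^sub>2) \<in> leU (X \<omega>) \<longrightarrow>
           (order_sup (leY (X \<omega>)) (G (X \<omega>) \<theta> \<epsilon>\<^sub>1),
            order_sup (leY (X \<omega>)) (G (X \<omega>) \<theta> \<epsilon>\<^sub>2)) \<in> leY (X \<omega>) \<and>
           (order_inf (leY (X \<omega>)) (G (X \<omega>) \<theta> \<epsilon>\<^sub>1),
            order_inf (leY (X \<omega>)) (G (X \<omega>) \<theta> \<epsilon>\<^sub>2)) \<in> leY (X \<omega>)"
    and "\<And>x. x \<in> X ` space M \<Longrightarrow> increasing_listing Y (leY x) (y x)"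
  shows "AE \<omega> in M. \<forall>\<theta>\<in>\<Theta>.
           core_determining Y
             (\<lambda>A. measure (\<nu> (X \<omega>) \<theta>) {\<epsilon>. G (X \<omega>) \<theta> \<epsilon> \<inter> A \<noteq> {}})
             (\<Union>i\<in>{1..card Y}. {y (X \<omega>) ` {1..i}, y (X \<omega>) ` {i..card Y}})"
  using assms(6,9,10) AE_space
\<comment> \<open>In each almost sure assumption the quantifier over \<open>\<theta>\<close> stands
  inside, so one null set serves all \<open>\<theta>\<close>. \<open>AE_space\<close> provides
  \<open>\<omega> \<in> space M\<close>, under which the assumptions on values of \<open>X\<close>
  apply.\<close>
proof eventually_elim
  case (elim \<omega>)
  show ?case
  proof
    fix \<theta> assume \<theta>: "\<theta> \<in> \<Theta>"
    have x: "X \<omega> \<in> X ` space M" using elim(4) by blast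
    have \<nu>: "prob_space (\<nu> (X \<omega>) \<theta>)" "sets (\<nu> (X \<omega>) \<theta>) = sets borel"
      using assms(4)[OF x \<theta>] by auto
    have space: "space (\<nu> (X \<omega>) \<theta>) = UNIV"
      using sets_eq_imp_space_eq[OF \<nu>(2)] by simp
    show "core_determining Y
             (\<lambda>A. measure (\<nu> (X \<omega>) \<theta>) {\<epsilon>. G (X \<omega>) \<theta> \<epsilon> \<inter> A \<noteq> {}})
             (\<Union>i\<in>{1..card Y}. {y (X \<omega>) ` {1..i}, y (X \<omega>) ` {i..card Y}})"
    proof (rule core_determining_half_lines[where U = "leU (X \<omega>)"])
      \<comment> \<open>Measurability is assumed for \<open>borel\<close> and carries over because
        \<open>\<nu> (X \<omega>) \<theta>\<close> has the same space and the same measurable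
        sets.\<close>
      show "measurable_correspondence (\<nu> (X \<omega>) \<theta>) Y (G (X \<omega>) \<theta>)"
        using elim(1) \<theta> \<nu>(2) space by (simp add: measurable_correspondence_def)
    qed (use assms(5,7,8,11) x \<theta> \<nu> space elim in \<open>auto simp: preorder_on_def\<close>)
  qed
qed

end
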